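(* Let $\phi:\mathbb{U}\to\mathbb{U}$ be analytic and let $\psi$ be analytic on $\mathbb{U}$ such that $W_{\psi,\phi}$ is bounded on $H^2(\mathbb{U})$. Then $W_{\psi,\phi}$ is unitary on $H^2(\mathbb{U})$ if and only if $\phi$ is an automorphism of $\mathbb{U}$ and $\psi = c\,K_\beta/\|K_\beta\|$, where $\beta\in\mathbb{U}$ is the point with $\phi(\beta)=0$ and $c$ is a complex constant with $|c|=1$.
   Context: $\mathbb{U}$ is the open unit disc in $\mathbb{C}$. $H^2(\mathbb{U})$ is the Hardy space of analytic functions on $\mathbb{U}$ with square-summable Maclaurin coefficients, a Hilbert space with inner product $\langle f,g\rangle=\sum_{n\ge 0}\hat f(n)\overline{\hat g(n)}$, where $\hat f(n)$ are the Maclaurin coefficients, and norm $\|\cdot\|$. The weighted composition operator is $W_{\psi,\phi}f=\psi\cdot(f\circ\phi)$. For $\beta\in\mathbb{U}$, $K_\beta(z)=1/(1-\bar\beta z)$ is the reproducing kernel of $H^2(\mathbb{U})$ at $\beta$. An automorphism of $\mathbb{U}$ is a bijective analytic map of $\mathbb{U}$ onto itself. *)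

theory Defs
  imports "HOL-Complex_Analysis.Complex_Analysis"
begin

abbreviation unit_disc :: "complex set" where
  "unit_disc \<equiv> ball 0 1"

definition disc_automorphism :: "(complex \<Rightarrow> complex) \<Rightarrow> bool" where
  "disc_automorphism \<phi> \<longleftrightarrow> \<phi> holomorphic_on unit_disc \<and> bij_betw \<phi> unit_disc unit_disc"

abbreviation maclaurin_coeff :: "(complex \<Rightarrow> complex) \<Rightarrow> nat \<Rightarrow> complex" where
  "maclaurin_coeff f n \<equiv> fps_nth (fps_expansion f 0) n"

text \<open>
  A function on the disc is represented by the total function that agrees with it on the disc
  and vanishes elsewhere, so that HOL equality of two elements of the Hardy space is equality
  on the disc.
\<close>

definition hardy2 :: "(complex \<Rightarrow> complex) set" where
  "hardy2 = {f. f holomorphic_on unit_disc \<and>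
                summable (\<lambda>n. (cmod (maclaurin_coeff f n))\<^sup>2) \<and>
                (\<forall>z. z \<notin> unit_disc \<longrightarrow> f z = 0)}"

definition hardy_inner :: "(complex \<Rightarrow> complex) \<Rightarrow> (complex \<Rightarrow> complex) \<Rightarrow> complex" where
  "hardy_inner f g = (\<Sum>n. maclaurin_coeff f n * cnj (maclaurin_coeff g n))"

definition hardy_norm :: "(complex \<Rightarrow> complex) \<Rightarrow> real" where
  "hardy_norm f = sqrt (Re (hardy_inner f f))"

definition hardy_kernel :: "complex \<Rightarrow> complex \<Rightarrow> complex" where
  "hardy_kernel \<beta> z = (if z \<in> unit_disc then 1 / (1 - cnj \<beta> * z) else 0)"

definition weighted_comp ::
  "(complex \<Rightarrow> complex) \<Rightarrow> (complex \<Rightarrow> complex) \<Rightarrow> (complex \<Rightarrow> complex) \<Rightarrow> (complex \<Rightarrow> complex)" where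
  "weighted_comp \<psi> \<phi> f = (\<lambda>z. if z \<in> unit_disc then \<psi> z * f (\<phi> z) else 0)"

definition hardy_bounded_operator ::
  "((complex \<Rightarrow> complex) \<Rightarrow> (complex \<Rightarrow> complex)) \<Rightarrow> bool" where
  "hardy_bounded_operator T \<longleftrightarrow>
     (\<forall>f\<in>hardy2. T f \<in> hardy2) \<and>
     (\<forall>f\<in>hardy2. \<forall>g\<in>hardy2. T (\<lambda>z. f z + g z) = (\<lambda>z. T f z + T g z)) \<and>
     (\<forall>a. \<forall>f\<in>hardy2. T (\<lambda>z. a * f z) = (\<lambda>z. a * T f z)) \<and>
     (\<exists>C. \<forall>f\<in>hardy2. hardy_norm (T f) \<le> C * hardy_norm f)"

definition hardy_adjoint ::
  "((complex \<Rightarrow> complex) \<Rightarrow> (complex \<Rightarrow> complex)) \<Rightarrow>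
   ((complex \<Rightarrow> complex) \<Rightarrow> (complex \<Rightarrow> complex)) \<Rightarrow> bool" where
  "hardy_adjoint T S \<longleftrightarrow>
     (\<forall>g\<in>hardy2. S g \<in> hardy2) \<and>
     (\<forall>f\<in>hardy2. \<forall>g\<in>hardy2. hardy_inner (T f) g = hardy_inner f (S g))"

definition hardy_unitary ::
  "((complex \<Rightarrow> complex) \<Rightarrow> (complex \<Rightarrow> complex)) \<Rightarrow> bool" where
  "hardy_unitary T \<longleftrightarrow>
     hardy_bounded_operator T \<and>
     (\<exists>S. hardy_adjoint T S \<and> (\<forall>f\<in>hardy2. S (T f) = f) \<and> (\<forall>f\<in>hardy2. T (S f) = f))"

end

theory Submission
  imports Defs
begin

text \<open>
  If \<open>W = W\<^bsub>\<psi>,\<phi>\<^esub>\<close> is unitary, its adjoint maps \<open>K\<^sub>z\<close> to \<open>cnj (\<psi> z) K\<^bsub>\<phi> z\<^esub>\<close>, so \<open>W W* K\<^sub>z = K\<^sub>z\<close> reads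
  \<open>\<psi> w cnj (\<psi> z) (1 - cnj z w) = 1 - cnj (\<phi> z) \<phi> w\<close>. Following \<open>\<phi>\<close> by the Moebius map that sends
  \<open>\<phi> 0\<close> to \<open>0\<close> gives a map \<open>\<xi>\<close> with \<open>cnj (\<xi> z) \<xi> w = cnj z w\<close>, hence a rotation, and \<open>\<phi>\<close> is an
  automorphism; taking \<open>z = \<beta>\<close> in the identity gives \<open>\<psi>\<close>.

  Conversely, an automorphism vanishing at \<open>\<beta>\<close> is a rotated Blaschke factor. Multiplication by such
  a factor preserves the norm, and its range is orthogonal to \<open>K\<^sub>\<beta>\<close>; therefore \<open>W\<close> is isometric on
  polynomials, and by convergence of coefficients contractive on the whole space. The inverse of
  \<open>W\<close> has the same form, so both are isometries.
\<close>

section \<open>Maclaurin coefficients on the unit disc\<close>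

text \<open>Coefficients see only the germ at 0. This lets functions cut off to 0 outside the disc
  be exchanged with closed formulas that are not cut off.\<close>

lemma maclaurin_coeff_cong:
  assumes "\<And>z. z \<in> unit_disc \<Longrightarrow> f z = g z"
  shows "maclaurin_coeff f n = maclaurin_coeff g n"
proof -
  have "eventually (\<lambda>z. z \<in> unit_disc) (nhds (0::complex))"
    by (intro eventually_nhds_in_open) auto
  then have "eventually (\<lambda>z. f z = g z) (nhds 0)"
    by eventually_elim (use assms in auto)
  then show ?thesis
    by (simp add: fps_expansion_cong)
qed

lemma holomorphic_has_maclaurin_expansion:
  assumes "f holomorphic_on unit_disc"
  shows "f has_fps_expansion fps_expansion f 0"
  using assms by (intro has_fps_expansion_fps_expansion[of unit_disc]) auto

lemma maclaurin_coeff_add: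
  assumes "f holomorphic_on unit_disc" "g holomorphic_on unit_disc"
  shows "maclaurin_coeff (\<lambda>z. f z + g z) n = maclaurin_coeff f n + maclaurin_coeff g n"
  using fps_expansion_eqI[OF has_fps_expansion_add[OF assms[THEN holomorphic_has_maclaurin_expansion]]]
  by simp

lemma fps_expansion_mult:
  assumes "f holomorphic_on unit_disc" "g holomorphic_on unit_disc"
  shows "fps_expansion (\<lambda>z. f z * g z) 0 = fps_expansion f 0 * fps_expansion g 0"
  using fps_expansion_eqI[OF has_fps_expansion_mult[OF assms[THEN holomorphic_has_maclaurin_expansion]]]
  by simp

lemma maclaurin_coeff_cmult:
  assumes "f holomorphic_on unit_disc"
  shows "maclaurin_coeff (\<lambda>z. a * f z) n = a * maclaurin_coeff f n"
  using fps_expansion_eqI[OF has_fps_expansion_cmult_left[OF assms[THEN holomorphic_has_maclaurin_expansion]], of a]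
  by simp

lemma maclaurin_coeff_add_cmult:
  assumes "f holomorphic_on unit_disc" "g holomorphic_on unit_disc"
  shows "maclaurin_coeff (\<lambda>z. f z + a * g z) n = maclaurin_coeff f n + a * maclaurin_coeff g n"
  using assms by (simp add: maclaurin_coeff_add maclaurin_coeff_cmult holomorphic_on_mult)

lemma maclaurin_coeff_times_id:
  assumes "f holomorphic_on unit_disc"
  shows "maclaurin_coeff (\<lambda>z. z * f z) n = (if n = 0 then 0 else maclaurin_coeff f (n - 1))"
  using fps_expansion_eqI[OF has_fps_expansion_mult[OF has_fps_expansion_fps_X holomorphic_has_maclaurin_expansion[OF assms]]]
  by simp

lemma maclaurin_sums:
  assumes "f holomorphic_on unit_disc" "w \<in> unit_disc"
  shows "(\<lambda>n. maclaurin_coeff f n * w ^ n) sums f w"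
  using holomorphic_power_series[OF assms] by (simp add: fps_expansion_def)

section \<open>The reproducing kernel\<close>

lemma one_minus_cnj_mult_nonzero:
  assumes "cmod \<beta> * cmod z < 1"
  shows "1 - cnj \<beta> * z \<noteq> 0"
proof
  assume "1 - cnj \<beta> * z = 0"
  then have "cmod (cnj \<beta> * z) = 1" by simp
  with assms show False by (simp add: norm_mult)
qed

lemma norm_mult_less_one:
  assumes "cmod \<beta> < 1" "cmod z < 1"
  shows "cmod \<beta> * cmod z < 1"
  using norm_mult_less[OF assms] by (simp add: norm_mult)

lemma hardy_kernel_denom_nonzero:
  assumes "cmod \<beta> < 1" "cmod z < 1"
  shows "1 - cnj \<beta> * z \<noteq> 0"
  using assms by (intro one_minus_cnj_mult_nonzero norm_mult_less_one)

lemma maclaurin_coeff_geometric: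
  assumes "cmod \<beta> < 1"
  shows "maclaurin_coeff (\<lambda>z. 1 / (1 - cnj \<beta> * z)) n = cnj \<beta> ^ n"
proof -
  have "(\<lambda>z. 1 / (1 - cnj \<beta> * z)) has_fps_expansion Abs_fps (\<lambda>n. cnj \<beta> ^ n)"
  proof (rule has_fps_expansionI)
    have "eventually (\<lambda>z. z \<in> unit_disc) (nhds (0::complex))"
      by (intro eventually_nhds_in_open) auto
    then show "\<forall>\<^sub>F z in nhds 0. (\<lambda>n. fps_nth (Abs_fps (\<lambda>n. cnj \<beta> ^ n)) n * z ^ n) sums (1 / (1 - cnj \<beta> * z))"
    proof eventually_elim
      case (elim z)
      then have "cmod (cnj \<beta> * z) < 1"
        using norm_mult_less_one[OF assms, of z] by (simp add: norm_mult)
      from geometric_sums[OF this] show ?case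
        by (simp add: power_mult_distrib)
    qed
  qed
  then show ?thesis
    by (simp add: fps_expansion_eqI)
qed

lemma maclaurin_coeff_hardy_kernel:
  assumes "cmod \<beta> < 1"
  shows "maclaurin_coeff (hardy_kernel \<beta>) n = cnj \<beta> ^ n"
  using maclaurin_coeff_cong[of "hardy_kernel \<beta>" "\<lambda>z. 1 / (1 - cnj \<beta> * z)"]
    maclaurin_coeff_geometric[OF assms]
  by (simp add: hardy_kernel_def)

lemma norm_square_power_sums:
  assumes "cmod \<beta> < 1"
  shows "(\<lambda>n. (cmod (cnj \<beta> ^ n))\<^sup>2) sums (1 / (1 - (cmod \<beta>)\<^sup>2))"
proof -
  have "norm ((cmod \<beta>)\<^sup>2) < 1"
    using assms by (simp add: power2_eq_square norm_mult_less_one)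
  from geometric_sums[OF this] show ?thesis
    by (simp add: norm_power power_mult mult.commute flip: power_mult)
qed

lemma hardy_kernel_in_hardy2:
  assumes "cmod \<beta> < 1"
  shows "hardy_kernel \<beta> \<in> hardy2"
proof -
  have "(\<lambda>z. 1 / (1 - cnj \<beta> * z)) holomorphic_on unit_disc"
    using hardy_kernel_denom_nonzero[OF assms] by (intro holomorphic_intros) auto
  then have "hardy_kernel \<beta> holomorphic_on unit_disc"
    by (rule holomorphic_transform) (auto simp: hardy_kernel_def)
  then show ?thesis
    using norm_square_power_sums[OF assms, THEN sums_summable]
    by (simp add: hardy2_def maclaurin_coeff_hardy_kernel[OF assms] hardy_kernel_def)
qed

text \<open>Reproducing property: conjugating the coefficients \<open>cnj \<beta> ^ n\<close> of the
  kernel turns the pairing into the Maclaurin series of \<open>f\<close> at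
  \<open>\<beta>\<close>.\<close>

lemma hardy_inner_kernel:
  assumes "f holomorphic_on unit_disc" "\<beta> \<in> unit_disc"
  shows "hardy_inner f (hardy_kernel \<beta>) = f \<beta>"
  using maclaurin_sums[OF assms] assms(2)
  by (simp add: hardy_inner_def maclaurin_coeff_hardy_kernel sums_iff)

section \<open>Norm, inner product and polarization in the Hardy space\<close>

lemma hardy2_holomorphic: "f \<in> hardy2 \<Longrightarrow> f holomorphic_on unit_disc"
  and hardy2_summable: "f \<in> hardy2 \<Longrightarrow> summable (\<lambda>n. (cmod (maclaurin_coeff f n))\<^sup>2)"
  by (auto simp: hardy2_def)

lemma hardy2_inner_summable:
  assumes "f \<in> hardy2" "g \<in> hardy2"
  shows "summable (\<lambda>n. maclaurin_coeff f n * cnj (maclaurin_coeff g n))"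
proof (rule summable_comparison_test')
  show "summable (\<lambda>n. (cmod (maclaurin_coeff f n))\<^sup>2 + (cmod (maclaurin_coeff g n))\<^sup>2)"
    using assms by (intro summable_add hardy2_summable)
  fix n
  show "norm (maclaurin_coeff f n * cnj (maclaurin_coeff g n))
      \<le> (cmod (maclaurin_coeff f n))\<^sup>2 + (cmod (maclaurin_coeff g n))\<^sup>2"
    using sum_squares_bound[of "cmod (maclaurin_coeff f n)" "cmod (maclaurin_coeff g n)"]
      mult_nonneg_nonneg[OF norm_ge_zero norm_ge_zero, of "maclaurin_coeff f n" "maclaurin_coeff g n"]
    unfolding norm_mult complex_mod_cnj by linarith
qed

lemma hardy_norm_eq:
  assumes "summable (\<lambda>n. (cmod (maclaurin_coeff f n))\<^sup>2)"
  shows "hardy_norm f = sqrt (\<Sum>n. (cmod (maclaurin_coeff f n))\<^sup>2)"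
proof -
  have "(\<lambda>n. maclaurin_coeff f n * cnj (maclaurin_coeff f n))
      sums complex_of_real (\<Sum>n. (cmod (maclaurin_coeff f n))\<^sup>2)"
    unfolding complex_norm_square[symmetric] by (intro sums_of_real summable_sums assms)
  then have "hardy_inner f f = complex_of_real (\<Sum>n. (cmod (maclaurin_coeff f n))\<^sup>2)"
    by (simp add: hardy_inner_def sums_iff)
  then show ?thesis
    by (simp add: hardy_norm_def)
qed

lemma hardy_norm_square:
  assumes "f \<in> hardy2"
  shows "(hardy_norm f)\<^sup>2 = (\<Sum>n. (cmod (maclaurin_coeff f n))\<^sup>2)"
proof -
  have "(\<Sum>n. (cmod (maclaurin_coeff f n))\<^sup>2) \<ge> 0"
    using hardy2_summable[OF assms] by (intro suminf_nonneg) auto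
  then show "(hardy_norm f)\<^sup>2 = (\<Sum>n. (cmod (maclaurin_coeff f n))\<^sup>2)"
    by (simp add: hardy_norm_eq[OF hardy2_summable[OF assms]])
qed

lemma hardy_norm_kernel:
  assumes "cmod \<beta> < 1"
  shows "hardy_norm (hardy_kernel \<beta>) = 1 / sqrt (1 - (cmod \<beta>)\<^sup>2)"
  using norm_square_power_sums[OF assms]
  by (simp add: hardy_norm_eq maclaurin_coeff_hardy_kernel[OF assms] sums_iff real_sqrt_divide)

lemma hardy2_add:
  assumes f: "f \<in> hardy2" and g: "g \<in> hardy2"
  shows "(\<lambda>z. f z + g z) \<in> hardy2"
proof -
  note hol = f[THEN hardy2_holomorphic] g[THEN hardy2_holomorphic]
  have "summable (\<lambda>n. (cmod (maclaurin_coeff f n + maclaurin_coeff g n))\<^sup>2)"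
  proof (rule summable_comparison_test')
    show "summable (\<lambda>n. 2 * (cmod (maclaurin_coeff f n))\<^sup>2 + 2 * (cmod (maclaurin_coeff g n))\<^sup>2)"
      using assms by (intro summable_add summable_mult hardy2_summable)
    fix n
    show "norm ((cmod (maclaurin_coeff f n + maclaurin_coeff g n))\<^sup>2)
        \<le> 2 * (cmod (maclaurin_coeff f n))\<^sup>2 + 2 * (cmod (maclaurin_coeff g n))\<^sup>2"
      using power_mono[OF norm_triangle_ineq[of "maclaurin_coeff f n" "maclaurin_coeff g n"], of 2]
        sum_squares_bound[of "cmod (maclaurin_coeff f n)" "cmod (maclaurin_coeff g n)"]
      by (simp add: power2_sum)
  qed
  with f g hol show ?thesis
    by (auto simp: hardy2_def maclaurin_coeff_add intro!: holomorphic_intros)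
qed

lemma hardy2_cmult:
  assumes "f \<in> hardy2"
  shows "(\<lambda>z. a * f z) \<in> hardy2"
  using assms summable_mult[OF hardy2_summable[OF assms], of "(cmod a)\<^sup>2"] hardy2_holomorphic[OF assms]
  by (auto simp: hardy2_def maclaurin_coeff_cmult norm_mult power_mult_distrib intro!: holomorphic_intros)

text \<open>Applied coefficient by coefficient, this expansion drives the polarization argument, the
  Blaschke telescoping and the orthogonality step of the polynomial induction.\<close>

lemma cmod_add_cmult_square:
  "(cmod (x + a * y))\<^sup>2 = (cmod x)\<^sup>2 + (cmod a)\<^sup>2 * (cmod y)\<^sup>2 + 2 * Re (cnj a * (x * cnj y))"
  by (simp only: cmod_power2) (simp add: power2_eq_square algebra_simps)

lemma hardy_norm_add_square:
  assumes f: "f \<in> hardy2" and g: "g \<in> hardy2"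
  shows "(hardy_norm (\<lambda>z. f z + a * g z))\<^sup>2 =
         (hardy_norm f)\<^sup>2 + (cmod a)\<^sup>2 * (hardy_norm g)\<^sup>2 + 2 * Re (cnj a * hardy_inner f g)"
proof -
  note hol = f[THEN hardy2_holomorphic] g[THEN hardy2_holomorphic]
  let ?f = "maclaurin_coeff f" and ?g = "maclaurin_coeff g"
  have "(\<lambda>n. (cmod (?f n))\<^sup>2 + (cmod a)\<^sup>2 * (cmod (?g n))\<^sup>2 + 2 * Re (cnj a * (?f n * cnj (?g n))))
      sums ((hardy_norm f)\<^sup>2 + (cmod a)\<^sup>2 * (hardy_norm g)\<^sup>2 + 2 * Re (cnj a * hardy_inner f g))"
    unfolding hardy_norm_square[OF f] hardy_norm_square[OF g] hardy_inner_def
    by (intro sums_add sums_mult sums_Re summable_sums hardy2_summable hardy2_inner_summable f g)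
  moreover have "(cmod (?f n))\<^sup>2 + (cmod a)\<^sup>2 * (cmod (?g n))\<^sup>2 + 2 * Re (cnj a * (?f n * cnj (?g n)))
      = (cmod (maclaurin_coeff (\<lambda>z. f z + a * g z) n))\<^sup>2" for n
    using hol
    by (simp add: maclaurin_coeff_add_cmult cmod_add_cmult_square)
  ultimately show ?thesis
    using hardy_norm_square[OF hardy2_add[OF f hardy2_cmult[OF g]]] by (simp add: sums_iff)
qed

text \<open>Polarization: comparing the squared norms of \<open>f + a g\<close> and of its image
  leaves only the cross term. The choice \<open>a = 1\<close> gives equal real parts,
  \<open>a = \<i>\<close> equal imaginary parts.\<close>

lemma hardy_isometry_inner:
  assumes T: "\<And>f. f \<in> hardy2 \<Longrightarrow> T f \<in> hardy2"
    and lin: "\<And>f g a. f \<in> hardy2 \<Longrightarrow> g \<in> hardy2 \<Longrightarrow> T (\<lambda>z. f z + a * g z) = (\<lambda>z. T f z + a * T g z)"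
    and iso: "\<And>f. f \<in> hardy2 \<Longrightarrow> hardy_norm (T f) = hardy_norm f"
    and f: "f \<in> hardy2" and g: "g \<in> hardy2"
  shows "hardy_inner (T f) (T g) = hardy_inner f g"
proof -
  have *: "Re (cnj a * hardy_inner (T f) (T g)) = Re (cnj a * hardy_inner f g)" for a
    using hardy_norm_add_square[OF f g, of a] hardy_norm_add_square[OF T[OF f] T[OF g], of a]
      iso[OF hardy2_add[OF f hardy2_cmult[OF g, of a]]] iso[OF f] iso[OF g] lin[OF f g, of a]
    by simp
  show ?thesis
    using *[of 1] *[of \<i>] by (simp add: complex_eq_iff)
qed

section \<open>Multiplication by a Blaschke factor\<close>

text \<open>The bound on \<open>R\<close> keeps the pole \<open>1 / cnj \<beta>\<close> out of the
  open disc of radius \<open>R\<close>. Later \<open>R > 1\<close>, so there is room beyond the unit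
  circle.\<close>

lemma blaschke_denom_nonzero:
  assumes "cmod \<beta> * R \<le> 1" "z \<in> ball 0 R"
  shows "1 - cnj \<beta> * z \<noteq> 0"
proof (rule one_minus_cnj_mult_nonzero)
  show "cmod \<beta> * cmod z < 1"
  proof (cases "\<beta> = 0")
    case False
    then have "cmod \<beta> * cmod z < cmod \<beta> * R" using assms(2) by simp
    with assms(1) show ?thesis by simp
  qed simp
qed

text \<open>Since \<open>R > 1\<close>, the Maclaurin series converges at the point 1, where its
  terms are the coefficients themselves.\<close>

lemma holomorphic_coeff_tendsto_0:
  assumes "h holomorphic_on ball 0 R" "R > 1"
  shows "(\<lambda>n. maclaurin_coeff h n) \<longlonglongrightarrow> 0"
proof -
  have "(\<lambda>n. (deriv ^^ n) h 0 / fact n * (1 - 0) ^ n) sums h 1"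
    using assms by (intro holomorphic_power_series[of h 0 R 1]) auto
  from summable_LIMSEQ_zero[OF sums_summable[OF this]] show ?thesis
    by (simp add: fps_expansion_def)
qed

text \<open>
  Writing \<open>f = (1 - cnj \<beta> z) h\<close>, the squared coefficients of \<open>f\<close> and of its product with
  the Blaschke factor, which is \<open>(z - \<beta>) h\<close>, differ by a telescoping term.
\<close>

lemma blaschke_factor_sums:
  assumes R: "R > 1" "cmod \<beta> * R \<le> 1"
    and f: "f holomorphic_on ball 0 R"
    and s: "(\<lambda>n. (cmod (maclaurin_coeff f n))\<^sup>2) sums s"
  shows "(\<lambda>n. (cmod (maclaurin_coeff (\<lambda>z. (z - \<beta>) / (1 - cnj \<beta> * z) * f z) n))\<^sup>2) sums s"
proof -
  have nz: "1 - cnj \<beta> * z \<noteq> 0" if "z \<in> ball 0 R" for z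
    using blaschke_denom_nonzero[OF R(2) that] .
  define h where "h = (\<lambda>z. f z / (1 - cnj \<beta> * z))"
  have h: "h holomorphic_on ball 0 R"
    unfolding h_def using f nz by (intro holomorphic_intros) auto
  have sub: "unit_disc \<subseteq> ball 0 R" using R by auto
  have h1: "h holomorphic_on unit_disc"
    using h sub by (rule holomorphic_on_subset)
  define a where "a = maclaurin_coeff h"
  \<comment> \<open>The coefficients of \<open>z * h z\<close>: those of \<open>h\<close> shifted by
    one, with \<open>b 0 = 0\<close>.\<close>
  define b where "b = (\<lambda>n. if n = 0 then 0 else a (n - 1))"
  have zh: "(\<lambda>z. z * h z) holomorphic_on unit_disc"
    using h1 by (intro holomorphic_intros)
  have fa: "maclaurin_coeff f n = a n + (- cnj \<beta>) * b n" for n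
  proof -
    have "maclaurin_coeff f n = maclaurin_coeff (\<lambda>z. h z + (- cnj \<beta>) * (z * h z)) n"
      by (rule maclaurin_coeff_cong) (use nz sub in \<open>auto simp: h_def field_simps\<close>)
    also have "\<dots> = a n + (- cnj \<beta>) * b n"
      using h1 zh
      unfolding maclaurin_coeff_add_cmult[OF h1 zh] by (simp add: maclaurin_coeff_times_id a_def b_def)
    finally show ?thesis .
  qed
  have ma: "maclaurin_coeff (\<lambda>z. (z - \<beta>) / (1 - cnj \<beta> * z) * f z) n = b n + (- \<beta>) * a n" for n
  proof -
    have "maclaurin_coeff (\<lambda>z. (z - \<beta>) / (1 - cnj \<beta> * z) * f z) n
        = maclaurin_coeff (\<lambda>z. z * h z + (- \<beta>) * h z) n"
      by (rule maclaurin_coeff_cong) (simp add: h_def diff_divide_distrib algebra_simps)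
    also have "\<dots> = b n + (- \<beta>) * a n"
      using h1 zh
      unfolding maclaurin_coeff_add_cmult[OF zh h1] by (simp add: maclaurin_coeff_times_id a_def b_def)
    finally show ?thesis .
  qed
  define t where "t = (\<lambda>n. (cmod (b n))\<^sup>2)"
  have tS: "t (Suc n) = (cmod (a n))\<^sup>2" for n
    by (simp add: t_def b_def)
  have "(\<lambda>n. (cmod (a n))\<^sup>2) \<longlonglongrightarrow> 0"
    using tendsto_power[OF tendsto_norm[OF holomorphic_coeff_tendsto_0[OF h R(1)]], of 2]
    by (simp add: a_def)
  then have "t \<longlonglongrightarrow> 0"
    unfolding tS[symmetric] by (rule LIMSEQ_imp_Suc)
  \<comment> \<open>The sum is the limit of \<open>t\<close> minus \<open>t 0\<close>, and both are
    0.\<close>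
  from telescope_sums[OF this] have "(\<lambda>n. t (Suc n) - t n) sums 0"
    by (simp add: t_def b_def)
  from sums_diff[OF s sums_mult[OF this, of "1 - (cmod \<beta>)\<^sup>2"]]
  have "(\<lambda>n. (cmod (maclaurin_coeff f n))\<^sup>2 - (1 - (cmod \<beta>)\<^sup>2) * (t (Suc n) - t n)) sums s"
    by simp
  \<comment> \<open>The cross terms of \<open>a - cnj \<beta> b\<close> and
    \<open>b - \<beta> a\<close> are conjugate, so they have the same real part. What remains is
    \<open>(cmod a)^2 - (cmod b)^2\<close> with the factor
    \<open>1 - (cmod \<beta>)^2\<close>.\<close>
  moreover have "(cmod (maclaurin_coeff f n))\<^sup>2 - (1 - (cmod \<beta>)\<^sup>2) * (t (Suc n) - t n)
      = (cmod (b n + (- \<beta>) * a n))\<^sup>2" for n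
    unfolding fa cmod_add_cmult_square tS by (simp add: t_def algebra_simps)
  ultimately show ?thesis
    unfolding ma by simp
qed

section \<open>From polynomials to power series under composition\<close>

text \<open>Weierstrass M-test: the terms at the point \<open>r\<close>, which lies strictly inside
  the disc of convergence, form a summable majorant.\<close>

lemma power_series_uniform_limit:
  assumes f: "f holomorphic_on unit_disc" and r: "0 \<le> r" "r < 1"
  shows "uniform_limit (cball 0 r) (\<lambda>N z. \<Sum>k<N. maclaurin_coeff f k * z ^ k) f sequentially"
proof -
  have "fps_conv_radius (fps_expansion f 0) \<ge> ereal 1"
    using f by (intro conv_radius_fps_expansion) (simp only: eball_ereal)
  then have "ereal (norm (complex_of_real r)) < fps_conv_radius (fps_expansion f 0)"
    by (rule less_le_trans[rotated]) (use r in simp)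
  then have "summable (\<lambda>n. norm (maclaurin_coeff f n * of_real r ^ n))"
    unfolding fps_conv_radius_def by (rule abs_summable_in_conv_radius)
  then have sm: "summable (\<lambda>n. norm (maclaurin_coeff f n) * r ^ n)"
    using r by (simp add: norm_mult norm_power)
  have lim: "uniform_limit (cball 0 r) (\<lambda>N z. \<Sum>k<N. maclaurin_coeff f k * z ^ k)
      (\<lambda>z. \<Sum>k. maclaurin_coeff f k * z ^ k) sequentially"
  proof (rule Weierstrass_m_test[OF _ sm])
    fix n z
    assume "z \<in> cball (0::complex) r"
    then show "norm (maclaurin_coeff f n * z ^ n) \<le> norm (maclaurin_coeff f n) * r ^ n"
      unfolding norm_mult norm_power by (intro mult_left_mono power_mono) auto
  qed
  have "(\<Sum>k. maclaurin_coeff f k * z ^ k) = f z" if "z \<in> cball 0 r" for z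
    using sums_unique[OF maclaurin_sums[OF f, of z]] that r by simp
  then show ?thesis
    using uniform_limit_cong'[of "cball 0 r" "\<lambda>N z. \<Sum>k<N. maclaurin_coeff f k * z ^ k"
        "\<lambda>N z. \<Sum>k<N. maclaurin_coeff f k * z ^ k" "\<lambda>z. \<Sum>k. maclaurin_coeff f k * z ^ k" f sequentially] lim
    by (simp only:)
qed

text \<open>Near 0 the values of \<open>\<phi>\<close> stay in a smaller closed disc, where the
  partial sums of \<open>f\<close> converge uniformly. Uniform limits of holomorphic functions carry
  over to derivatives at 0.\<close>

lemma maclaurin_coeff_compose_limit:
  assumes f: "f holomorphic_on unit_disc" and \<phi>: "\<phi> holomorphic_on unit_disc" "\<phi> ` unit_disc \<subseteq> unit_disc"
    and \<psi>: "\<psi> holomorphic_on unit_disc"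
  shows "(\<lambda>N. maclaurin_coeff (\<lambda>z. \<psi> z * (\<Sum>k<N. maclaurin_coeff f k * \<phi> z ^ k)) n)
    \<longlonglongrightarrow> maclaurin_coeff (\<lambda>z. \<psi> z * f (\<phi> z)) n"
proof -
  \<comment> \<open>The midpoint between \<open>cmod (\<phi> 0)\<close> and 1, hence strictly
    between them.\<close>
  define r where "r = (1 + cmod (\<phi> 0)) / 2"
  have \<phi>0: "cmod (\<phi> 0) < 1" using \<phi>(2) by force
  then have r: "0 \<le> r" "r < 1" "cmod (\<phi> 0) < r" by (auto simp: r_def)
  define A where "A = unit_disc \<inter> \<phi> -` ball 0 r"
  have A: "open A" "0 \<in> A" "A \<subseteq> unit_disc"
    unfolding A_def using r holomorphic_on_imp_continuous_on[OF \<phi>(1)]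
    by (auto intro!: continuous_open_preimage)
  have ul: "uniform_limit A (\<lambda>N z. \<Sum>k<N. maclaurin_coeff f k * \<phi> z ^ k) (\<lambda>z. f (\<phi> z)) sequentially"
    using uniform_limit_compose'[OF power_series_uniform_limit[OF f r(1,2)], of \<phi> A]
    by (auto simp: A_def)
  have lim: "(\<lambda>N. maclaurin_coeff (\<lambda>z. \<Sum>k<N. maclaurin_coeff f k * \<phi> z ^ k) m)
      \<longlonglongrightarrow> maclaurin_coeff (\<lambda>z. f (\<phi> z)) m" for m
  proof -
    have "(\<lambda>N. (deriv ^^ m) (\<lambda>z. \<Sum>k<N. maclaurin_coeff f k * \<phi> z ^ k) 0)
        \<longlonglongrightarrow> (deriv ^^ m) (\<lambda>z. f (\<phi> z)) 0"
      using ul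
    proof (rule higher_deriv_complex_uniform_limit)
      show "\<forall>\<^sub>F N in sequentially. (\<lambda>z. \<Sum>k<N. maclaurin_coeff f k * \<phi> z ^ k) holomorphic_on A"
        using holomorphic_on_subset[OF \<phi>(1) A(3)] by (intro always_eventually allI holomorphic_intros)
    qed (use A in auto)
    then show ?thesis
      unfolding fps_expansion_def fps_nth_Abs_fps by (intro tendsto_divide) auto
  qed
  have hp: "(\<lambda>z. \<Sum>k<N. maclaurin_coeff f k * \<phi> z ^ k) holomorphic_on unit_disc" for N
    using \<phi>(1) by (intro holomorphic_intros)
  have hf: "(\<lambda>z. f (\<phi> z)) holomorphic_on unit_disc"
    using holomorphic_on_compose_gen[OF \<phi>(1) f \<phi>(2)] by (simp add: o_def)
  show ?thesis
    \<comment> \<open>Each coefficient of the product with \<open>\<psi>\<close> is a finite Cauchy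
      sum, so the limit may be taken term by term.\<close>
    unfolding fps_expansion_mult[OF \<psi> hp] fps_expansion_mult[OF \<psi> hf] fps_mult_nth
    by (rule tendsto_sum, rule tendsto_mult[OF tendsto_const lim])
qed

text \<open>
  The induction splits off the constant term \<open>a 0\<close>: the remainder is \<open>\<phi>\<close> times a shorter sum of
  the same shape, it has the norm of that shorter sum, and it is orthogonal to \<open>\<psi>\<close>, a multiple of
  the kernel at the zero \<open>\<beta>\<close> of \<open>\<phi>\<close>.
\<close>

lemma weighted_moebius_polynomial_sums:
  assumes \<beta>: "cmod \<beta> < 1" and \<mu>: "cmod \<mu> = 1" and d: "(cmod d)\<^sup>2 = 1 - (cmod \<beta>)\<^sup>2"
  defines "\<phi> \<equiv> \<lambda>z. \<mu> * ((z - \<beta>) / (1 - cnj \<beta> * z))"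
  defines "\<psi> \<equiv> \<lambda>z. d * (1 / (1 - cnj \<beta> * z))"
  shows "(\<lambda>n. (cmod (maclaurin_coeff (\<lambda>z. \<psi> z * (\<Sum>k<N. a k * \<phi> z ^ k)) n))\<^sup>2)
    sums (\<Sum>k<N. (cmod (a k))\<^sup>2)"
proof (induction N arbitrary: a)
  case 0
  then show ?case by (simp add: fps_expansion_eqI[of _ 0])
next
  case (Suc N)
  \<comment> \<open>A radius above 1 with \<open>cmod \<beta> * R \<le> 1\<close>: every function of
    the induction extends holomorphically past the unit circle, as
    \<open>blaschke_factor_sums\<close> requires.\<close>
  define R where "R = 2 / (1 + cmod \<beta>)"
  have R: "R > 1" "cmod \<beta> * R \<le> 1"
    using \<beta> add_pos_nonneg[OF zero_less_one norm_ge_zero, of \<beta>] by (simp_all add: R_def pos_less_divide_eq pos_divide_le_eq)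
  have nz: "1 - cnj \<beta> * z \<noteq> 0" if "z \<in> ball 0 R" for z
    using blaschke_denom_nonzero[OF R(2) that] .
  have sub: "unit_disc \<subseteq> ball 0 R" using R by auto
  have hol: "\<phi> holomorphic_on ball 0 R" "\<psi> holomorphic_on ball 0 R"
    unfolding \<phi>_def \<psi>_def using nz by (auto intro!: holomorphic_intros)
  define G where "G = (\<lambda>z. \<psi> z * (\<Sum>k<N. a (Suc k) * \<phi> z ^ k))"
  have G: "G holomorphic_on ball 0 R"
    unfolding G_def using hol by (intro holomorphic_intros)
  \<comment> \<open>The rotation \<open>\<mu>\<close> is left out so that \<open>F\<close> is
    exactly a Blaschke factor times \<open>G\<close>; it returns in
    \<open>\<mu> * F z = \<phi> z * G z\<close>.\<close>
  define F where "F = (\<lambda>z. (z - \<beta>) / (1 - cnj \<beta> * z) * G z)"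
  have F: "F holomorphic_on unit_disc"
    unfolding F_def using holomorphic_on_subset[OF G sub] nz sub by (intro holomorphic_intros) auto
  have \<psi>1: "\<psi> holomorphic_on unit_disc"
    using hol(2) sub by (rule holomorphic_on_subset)
  have \<psi>n: "maclaurin_coeff \<psi> n = d * cnj \<beta> ^ n" for n
  proof -
    have "(\<lambda>z. 1 / (1 - cnj \<beta> * z)) holomorphic_on unit_disc"
      using hardy_kernel_denom_nonzero[OF \<beta>] by (intro holomorphic_intros) auto
    then show ?thesis
      unfolding \<psi>_def by (simp only: maclaurin_coeff_cmult maclaurin_coeff_geometric[OF \<beta>])
  qed
  have "(cmod d)\<^sup>2 \<noteq> 0"
    using d \<beta> power_strict_mono[of "cmod \<beta>" 1 2] by simp
  then have \<psi>s: "(\<lambda>n. (cmod (maclaurin_coeff \<psi> n))\<^sup>2) sums 1"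
    using sums_mult[OF norm_square_power_sums[OF \<beta>], of "(cmod d)\<^sup>2"] d
    by (simp add: \<psi>n norm_mult power_mult_distrib)
  have Fs: "(\<lambda>n. (cmod (maclaurin_coeff F n))\<^sup>2) sums (\<Sum>k<N. (cmod (a (Suc k)))\<^sup>2)"
    unfolding F_def using blaschke_factor_sums[OF R G] Suc.IH[of "\<lambda>k. a (Suc k)", folded G_def] by blast
  \<comment> \<open>\<open>F\<close> vanishes at \<open>\<beta>\<close>. Up to the factor
    \<open>cnj d\<close>, this series is the pairing of \<open>F\<close> with
    \<open>\<psi>\<close>.\<close>
  have "(\<lambda>n. maclaurin_coeff F n * \<beta> ^ n) sums 0"
    using maclaurin_sums[OF F, of \<beta>] \<beta> by (simp add: F_def)
  from sums_mult[OF this, of "cnj d"]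
  have cross: "(\<lambda>n. maclaurin_coeff F n * cnj (maclaurin_coeff \<psi> n)) sums 0"
    by (simp add: \<psi>n mult_ac)
  have "(\<lambda>n. (cmod (\<mu> * maclaurin_coeff F n))\<^sup>2 + (cmod (a 0))\<^sup>2 * (cmod (maclaurin_coeff \<psi> n))\<^sup>2
         + 2 * Re (cnj (a 0) * (\<mu> * maclaurin_coeff F n * cnj (maclaurin_coeff \<psi> n))))
      sums ((\<Sum>k<N. (cmod (a (Suc k)))\<^sup>2) + (cmod (a 0))\<^sup>2 * 1 + 2 * Re (cnj (a 0) * (\<mu> * 0)))"
    unfolding mult.assoc[of \<mu>]
    by (intro sums_add sums_mult sums_Re cross \<psi>s) (use Fs in \<open>simp add: norm_mult \<mu>\<close>)
  also have "(\<Sum>k<N. (cmod (a (Suc k)))\<^sup>2) + (cmod (a 0))\<^sup>2 * 1 + 2 * Re (cnj (a 0) * (\<mu> * 0))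
      = (\<Sum>k<Suc N. (cmod (a k))\<^sup>2)"
    by (simp add: sum.lessThan_Suc_shift del: sum.lessThan_Suc)
  finally have "(\<lambda>n. (cmod (\<mu> * maclaurin_coeff F n + a 0 * maclaurin_coeff \<psi> n))\<^sup>2)
      sums (\<Sum>k<Suc N. (cmod (a k))\<^sup>2)"
    unfolding cmod_add_cmult_square .
  moreover have "\<mu> * maclaurin_coeff F n + a 0 * maclaurin_coeff \<psi> n
      = maclaurin_coeff (\<lambda>z. \<psi> z * (\<Sum>k<Suc N. a k * \<phi> z ^ k)) n" for n
  proof -
    have "(\<lambda>z. \<psi> z * (\<Sum>k<Suc N. a k * \<phi> z ^ k)) = (\<lambda>z. \<mu> * F z + a 0 * \<psi> z)"
    proof (rule ext)
      fix z
      have "(\<Sum>k<Suc N. a k * \<phi> z ^ k) = a 0 + \<phi> z * (\<Sum>k<N. a (Suc k) * \<phi> z ^ k)"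
        unfolding sum.lessThan_Suc_shift sum_distrib_left by (simp add: mult.left_commute)
      moreover have "\<mu> * F z = \<phi> z * G z"
        by (simp add: F_def \<phi>_def)
      ultimately show "\<psi> z * (\<Sum>k<Suc N. a k * \<phi> z ^ k) = \<mu> * F z + a 0 * \<psi> z"
        by (simp add: G_def algebra_simps del: sum.lessThan_Suc)
    qed
    then show ?thesis
      using F \<psi>1 by (simp add: maclaurin_coeff_add maclaurin_coeff_cmult holomorphic_on_mult del: sum.lessThan_Suc)
  qed
  ultimately show ?case by (simp only:)
qed

section \<open>Weighted composition with rotated Blaschke factors\<close>

lemma norm_rotated_moebius_less_one:
  assumes "cmod \<beta> < 1" "cmod \<mu> = 1" "cmod z < 1"
  shows "cmod (\<mu> * ((z - \<beta>) / (1 - cnj \<beta> * z))) < 1"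
  using Moebius_function_norm_lt_1[OF assms(1,3), of 0]
  by (simp only: norm_mult assms Moebius_function_simple mult_1)

text \<open>A Fatou-type argument: the partial sums of \<open>f\<close> are mapped isometrically and
  the coefficients of their images converge, so no finite block of coefficients of the image can
  exceed the norm of \<open>f\<close>.\<close>

lemma weighted_moebius_contraction:
  assumes \<beta>: "cmod \<beta> < 1" and \<mu>: "cmod \<mu> = 1" and d: "(cmod d)\<^sup>2 = 1 - (cmod \<beta>)\<^sup>2"
    and \<phi>: "\<And>z. z \<in> unit_disc \<Longrightarrow> \<phi> z = \<mu> * ((z - \<beta>) / (1 - cnj \<beta> * z))"
    and \<psi>: "\<And>z. z \<in> unit_disc \<Longrightarrow> \<psi> z = d * (1 / (1 - cnj \<beta> * z))"
    and f: "f \<in> hardy2"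
  shows "weighted_comp \<psi> \<phi> f \<in> hardy2"
    and "hardy_norm (weighted_comp \<psi> \<phi> f) \<le> hardy_norm f"
proof -
  define \<phi>' where "\<phi>' = (\<lambda>z. \<mu> * ((z - \<beta>) / (1 - cnj \<beta> * z)))"
  define \<psi>' where "\<psi>' = (\<lambda>z. d * (1 / (1 - cnj \<beta> * z)))"
  have hol: "\<phi>' holomorphic_on unit_disc" "\<psi>' holomorphic_on unit_disc"
    unfolding \<phi>'_def \<psi>'_def using hardy_kernel_denom_nonzero[OF \<beta>] by (auto intro!: holomorphic_intros)
  have img: "\<phi>' ` unit_disc \<subseteq> unit_disc"
    using norm_rotated_moebius_less_one[OF \<beta> \<mu>] by (auto simp only: \<phi>'_def mem_ball_0)
  note f1 = hardy2_holomorphic[OF f]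
  define g where "g = weighted_comp \<psi> \<phi> f"
  have g_eq: "g z = \<psi>' z * f (\<phi>' z)" if "z \<in> unit_disc" for z
    using that by (simp add: g_def weighted_comp_def \<phi> \<psi> \<phi>'_def \<psi>'_def)
  have "(\<lambda>z. f (\<phi>' z)) holomorphic_on unit_disc"
    using holomorphic_on_compose_gen[OF hol(1) f1 img] by (simp add: o_def)
  then have "(\<lambda>z. \<psi>' z * f (\<phi>' z)) holomorphic_on unit_disc"
    using hol(2) by (intro holomorphic_intros)
  then have g: "g holomorphic_on unit_disc"
    by (rule holomorphic_transform) (simp add: g_eq)
  have lim: "(\<lambda>N. maclaurin_coeff (\<lambda>z. \<psi>' z * (\<Sum>k<N. maclaurin_coeff f k * \<phi>' z ^ k)) n)
      \<longlonglongrightarrow> maclaurin_coeff g n" for n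
    using maclaurin_coeff_compose_limit[OF f1 hol(1) img hol(2)] maclaurin_coeff_cong[of g, OF g_eq] by simp
  \<comment> \<open>\<open>M\<close> stays fixed while the degree \<open>N\<close> tends to
    infinity, so only finitely many coefficient limits are combined.\<close>
  have bound: "(\<Sum>n<M. (cmod (maclaurin_coeff g n))\<^sup>2) \<le> (\<Sum>n. (cmod (maclaurin_coeff f n))\<^sup>2)" for M
  proof (rule LIMSEQ_le_const2)
    show "(\<lambda>N. \<Sum>n<M. (cmod (maclaurin_coeff (\<lambda>z. \<psi>' z * (\<Sum>k<N. maclaurin_coeff f k * \<phi>' z ^ k)) n))\<^sup>2)
        \<longlonglongrightarrow> (\<Sum>n<M. (cmod (maclaurin_coeff g n))\<^sup>2)"
      by (intro tendsto_sum tendsto_power tendsto_norm lim)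
    have "(\<Sum>n<M. (cmod (maclaurin_coeff (\<lambda>z. \<psi>' z * (\<Sum>k<N. maclaurin_coeff f k * \<phi>' z ^ k)) n))\<^sup>2)
        \<le> (\<Sum>n. (cmod (maclaurin_coeff f n))\<^sup>2)" for N
    proof -
      have s: "(\<lambda>n. (cmod (maclaurin_coeff (\<lambda>z. \<psi>' z * (\<Sum>k<N. maclaurin_coeff f k * \<phi>' z ^ k)) n))\<^sup>2)
          sums (\<Sum>k<N. (cmod (maclaurin_coeff f k))\<^sup>2)"
        unfolding \<phi>'_def \<psi>'_def by (rule weighted_moebius_polynomial_sums[OF \<beta> \<mu> d])
      have "(\<Sum>n<M. (cmod (maclaurin_coeff (\<lambda>z. \<psi>' z * (\<Sum>k<N. maclaurin_coeff f k * \<phi>' z ^ k)) n))\<^sup>2)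
          \<le> (\<Sum>k<N. (cmod (maclaurin_coeff f k))\<^sup>2)"
        unfolding sums_unique[OF s] by (rule sum_le_suminf[OF sums_summable[OF s]]) auto
      also have "\<dots> \<le> (\<Sum>n. (cmod (maclaurin_coeff f n))\<^sup>2)"
        by (rule sum_le_suminf[OF hardy2_summable[OF f]]) auto
      finally show ?thesis .
    qed
    then show "\<exists>N0. \<forall>N\<ge>N0. (\<Sum>n<M. (cmod (maclaurin_coeff (\<lambda>z. \<psi>' z * (\<Sum>k<N. maclaurin_coeff f k * \<phi>' z ^ k)) n))\<^sup>2)
        \<le> (\<Sum>n. (cmod (maclaurin_coeff f n))\<^sup>2)"
      by blast
  qed
  have sm: "summable (\<lambda>n. (cmod (maclaurin_coeff g n))\<^sup>2)"
    by (rule summableI_nonneg_bounded[OF _ bound]) simp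
  then have "g \<in> hardy2"
    using g by (simp add: hardy2_def) (simp add: g_def weighted_comp_def)
  then show "weighted_comp \<psi> \<phi> f \<in> hardy2"
    by (simp only: g_def)
  show "hardy_norm (weighted_comp \<psi> \<phi> f) \<le> hardy_norm f"
    using suminf_le_const[OF sm bound]
    unfolding g_def[symmetric] hardy_norm_eq[OF sm] hardy_norm_eq[OF hardy2_summable[OF f]]
    by (rule real_sqrt_le_mono)
qed

text \<open>The parameters \<open>\<mu>\<close>, \<open>\<beta>\<close>, \<open>d\<close> are
  inverted by \<open>cnj \<mu>\<close>, \<open>- \<mu> * \<beta>\<close>, \<open>cnj d\<close>. The
  second equation says that the two weights cancel along the map.\<close>

lemma moebius_inverse:
  assumes \<beta>: "cmod \<beta> < 1" and \<mu>: "cmod \<mu> = 1" and d: "(cmod d)\<^sup>2 = 1 - (cmod \<beta>)\<^sup>2" and z: "cmod z < 1"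
  defines "u \<equiv> \<mu> * ((z - \<beta>) / (1 - cnj \<beta> * z))"
  shows "cnj \<mu> * ((u - (- \<mu> * \<beta>)) / (1 - cnj (- \<mu> * \<beta>) * u)) = z"
    and "cnj d * (1 / (1 - cnj (- \<mu> * \<beta>) * u)) * (d * (1 / (1 - cnj \<beta> * z))) = 1"
proof -
  define D where "D = 1 - cnj \<beta> * z"
  have D: "D \<noteq> 0" using hardy_kernel_denom_nonzero[OF \<beta> z] by (simp add: D_def)
  have \<mu>': "cnj \<mu> * \<mu> = 1"
    using \<mu> complex_norm_square[of \<mu>] by (simp add: mult.commute)
  \<comment> \<open>This number is both the numerator left after clearing denominators and, by the
    choice of \<open>d\<close>, the product of the constants of the two weights.\<close>
  define k where "k = 1 - \<beta> * cnj \<beta>"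
  have kd: "k = cnj d * d"
    using d unfolding k_def complex_norm_square[symmetric] mult.commute[of "cnj d"]
    by (simp flip: of_real_power)
  have "(cmod d)\<^sup>2 \<noteq> 0"
    using d \<beta> power_strict_mono[of "cmod \<beta>" 1 2] by simp
  then have k: "k \<noteq> 0" by (simp add: kd)
  have e1: "1 - cnj (- \<mu> * \<beta>) * u = k / D"
  proof -
    have "1 - cnj (- \<mu> * \<beta>) * u = 1 + (cnj \<mu> * \<mu>) * cnj \<beta> * ((z - \<beta>) / D)"
      by (simp add: u_def D_def mult_ac)
    also have "\<dots> = k / D"
      unfolding \<mu>' using D by (simp add: field_simps) (simp add: D_def k_def algebra_simps)
    finally show ?thesis .
  qed
  have e2: "u - (- \<mu> * \<beta>) = \<mu> * (z * (k / D))"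
  proof -
    have "u - (- \<mu> * \<beta>) = \<mu> * ((z - \<beta>) / D + \<beta>)"
      by (simp add: u_def D_def algebra_simps)
    also have "(z - \<beta>) / D + \<beta> = z * (k / D)"
      using D by (simp add: field_simps) (simp add: D_def k_def algebra_simps)
    finally show ?thesis .
  qed
  show "cnj \<mu> * ((u - (- \<mu> * \<beta>)) / (1 - cnj (- \<mu> * \<beta>) * u)) = z"
    unfolding e1 e2 using D k \<mu>' by (simp flip: mult.assoc)
  show "cnj d * (1 / (1 - cnj (- \<mu> * \<beta>) * u)) * (d * (1 / (1 - cnj \<beta> * z))) = 1"
    unfolding e1 D_def[symmetric] using D k by (simp add: kd)
qed

text \<open>The norm of \<open>f = S (T f)\<close> is at most that of \<open>T f\<close>, so
  \<open>T\<close> is isometric. By polarization the pairing of \<open>T f\<close> with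
  \<open>g = T (S g)\<close> equals that of \<open>f\<close> with \<open>S g\<close>, so
  \<open>S\<close> is the adjoint.\<close>

lemma hardy_unitary_of_contractions:
  assumes T: "hardy_bounded_operator T"
    and S: "\<And>f. f \<in> hardy2 \<Longrightarrow> S f \<in> hardy2"
    and contr: "\<And>f. f \<in> hardy2 \<Longrightarrow> hardy_norm (T f) \<le> hardy_norm f"
      "\<And>f. f \<in> hardy2 \<Longrightarrow> hardy_norm (S f) \<le> hardy_norm f"
    and inv: "\<And>f. f \<in> hardy2 \<Longrightarrow> S (T f) = f" "\<And>f. f \<in> hardy2 \<Longrightarrow> T (S f) = f"
  shows "hardy_unitary T"
proof -
  have T2: "T f \<in> hardy2" if "f \<in> hardy2" for f
    using T that unfolding hardy_bounded_operator_def by blast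
  have add: "T (\<lambda>z. f z + g z) = (\<lambda>z. T f z + T g z)" if "f \<in> hardy2" "g \<in> hardy2" for f g
    using T that unfolding hardy_bounded_operator_def by blast
  have cmult: "T (\<lambda>z. a * f z) = (\<lambda>z. a * T f z)" if "f \<in> hardy2" for a f
    using T that unfolding hardy_bounded_operator_def by blast
  have lin: "T (\<lambda>z. f z + a * g z) = (\<lambda>z. T f z + a * T g z)" if "f \<in> hardy2" "g \<in> hardy2" for f g a
    unfolding add[OF that(1) hardy2_cmult[OF that(2)]] cmult[OF that(2)] ..
  have iso: "hardy_norm (T f) = hardy_norm f" if "f \<in> hardy2" for f
    using contr(1)[OF that] contr(2)[OF T2[OF that]] unfolding inv(1)[OF that] by (rule order_antisym)
  have "hardy_inner (T f) g = hardy_inner f (S g)" if f: "f \<in> hardy2" and g: "g \<in> hardy2" for f g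
  proof -
    have "hardy_inner (T f) (T (S g)) = hardy_inner f (S g)"
      by (rule hardy_isometry_inner) (use T2 lin iso f S[OF g] in blast)+
    then show ?thesis by (simp only: inv(2)[OF g])
  qed
  then have "hardy_adjoint T S"
    unfolding hardy_adjoint_def using S by blast
  then show ?thesis
    unfolding hardy_unitary_def using T inv by blast
qed

lemma weighted_moebius_unitary:
  assumes \<beta>: "cmod \<beta> < 1" and \<mu>: "cmod \<mu> = 1" and d: "(cmod d)\<^sup>2 = 1 - (cmod \<beta>)\<^sup>2"
    and \<phi>: "\<And>z. z \<in> unit_disc \<Longrightarrow> \<phi> z = \<mu> * ((z - \<beta>) / (1 - cnj \<beta> * z))"
    and \<psi>: "\<And>z. z \<in> unit_disc \<Longrightarrow> \<psi> z = d * (1 / (1 - cnj \<beta> * z))"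
    and T: "hardy_bounded_operator (weighted_comp \<psi> \<phi>)"
  shows "hardy_unitary (weighted_comp \<psi> \<phi>)"
proof -
  \<comment> \<open>\<open>\<gamma>\<close> is the value of \<open>\<phi>\<close> at 0, hence the
    zero of the inverse map.\<close>
  define \<gamma> where "\<gamma> = - \<mu> * \<beta>"
  define \<phi>' where "\<phi>' = (\<lambda>u. cnj \<mu> * ((u - \<gamma>) / (1 - cnj \<gamma> * u)))"
  define \<psi>' where "\<psi>' = (\<lambda>u. cnj d * (1 / (1 - cnj \<gamma> * u)))"
  have \<gamma>: "cmod \<gamma> < 1" "(cmod (cnj d))\<^sup>2 = 1 - (cmod \<gamma>)\<^sup>2"
    using \<beta> \<mu> d by (auto simp: \<gamma>_def norm_mult)
  have \<mu>': "cmod (cnj \<mu>) = 1" using \<mu> by simp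
  have "cnj \<mu> * \<mu> = 1"
    using \<mu> complex_norm_square[of \<mu>] by (simp add: mult.commute)
  \<comment> \<open>Inverting the parameters twice restores them, so \<open>moebius_inverse\<close>
    serves both orders of composition.\<close>
  then have \<gamma>\<beta>: "- cnj \<mu> * \<gamma> = \<beta>"
    by (simp add: \<gamma>_def flip: mult.assoc)
  have disc: "\<phi> z \<in> unit_disc" "\<phi>' z \<in> unit_disc" if "z \<in> unit_disc" for z
    using norm_rotated_moebius_less_one[OF \<beta> \<mu>, of z] norm_rotated_moebius_less_one[OF \<gamma>(1) \<mu>', of z] that
    by (simp_all only: \<phi> \<phi>'_def mem_ball_0)
  have l: "\<phi>' (\<phi> z) = z" "\<psi>' (\<phi> z) * \<psi> z = 1" if "z \<in> unit_disc" for z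
    using moebius_inverse[OF \<beta> \<mu> d, of z] that by (simp_all only: \<phi> \<psi> \<phi>'_def \<psi>'_def \<gamma>_def mem_ball_0)
  have r: "\<phi> (\<phi>' z) = z" "\<psi> (\<phi>' z) * \<psi>' z = 1" if "z \<in> unit_disc" for z
    using moebius_inverse[OF \<gamma>(1) \<mu>' \<gamma>(2), of z] that
    unfolding \<gamma>\<beta> complex_cnj_cnj \<phi>[OF disc(2)[OF that]] \<psi>[OF disc(2)[OF that]]
    by (simp_all only: \<phi>'_def \<psi>'_def mem_ball_0)
  show ?thesis
  proof (rule hardy_unitary_of_contractions[OF T])
    fix f assume f: "f \<in> hardy2"
    show "weighted_comp \<psi>' \<phi>' f \<in> hardy2" "hardy_norm (weighted_comp \<psi>' \<phi>' f) \<le> hardy_norm f"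
      by (rule weighted_moebius_contraction[OF \<gamma>(1) \<mu>' \<gamma>(2) _ _ f]; simp add: \<phi>'_def \<psi>'_def)+
    show "hardy_norm (weighted_comp \<psi> \<phi> f) \<le> hardy_norm f"
      by (rule weighted_moebius_contraction[OF \<beta> \<mu> d \<phi> \<psi> f])
    \<comment> \<open>Equality of functions is also needed off the disc, where weighted compositions
      are 0 by definition.\<close>
    have f0: "f z = 0" if "z \<notin> unit_disc" for z
      using f that by (simp add: hardy2_def)
    have cancel: "q * (p * x) = x" if "p * q = 1" for p q x :: complex
      using that by (simp add: mult.commute[of q] mult.left_commute[of q])
    show "weighted_comp \<psi>' \<phi>' (weighted_comp \<psi> \<phi> f) = f"
    proof
      fix z show "weighted_comp \<psi>' \<phi>' (weighted_comp \<psi> \<phi> f) z = f z"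
        using cancel[OF r(2)] r(1) disc(2) f0 by (cases "z \<in> unit_disc") (simp_all only: weighted_comp_def if_True if_False not_False_eq_True)
    qed
    show "weighted_comp \<psi> \<phi> (weighted_comp \<psi>' \<phi>' f) = f"
    proof
      fix z show "weighted_comp \<psi> \<phi> (weighted_comp \<psi>' \<phi>' f) z = f z"
        using cancel[OF l(2)] l(1) disc(1) f0 by (cases "z \<in> unit_disc") (simp_all only: weighted_comp_def if_True if_False not_False_eq_True)
    qed
  qed
qed

section \<open>Automorphisms of the disc as rotated Blaschke factors\<close>

text \<open>Moving \<open>\<beta>\<close> to 0 by a Moebius map makes both the automorphism and its
  inverse fix 0. The Schwarz lemma for both forces equality of moduli, hence a rotation.\<close>

lemma disc_automorphism_moebius:
  assumes \<phi>: "disc_automorphism \<phi>" and \<beta>: "\<beta> \<in> unit_disc" "\<phi> \<beta> = 0"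
  obtains \<mu> where "cmod \<mu> = 1" "\<And>z. z \<in> unit_disc \<Longrightarrow> \<phi> z = \<mu> * ((z - \<beta>) / (1 - cnj \<beta> * z))"
proof -
  have hol: "\<phi> holomorphic_on unit_disc" and bij: "bij_betw \<phi> unit_disc unit_disc"
    using \<phi> by (auto simp: disc_automorphism_def)
  have img: "\<phi> ` unit_disc = unit_disc" and inj: "inj_on \<phi> unit_disc"
    using bij by (auto simp: bij_betw_def)
  obtain \<theta> where \<theta>: "\<theta> holomorphic_on unit_disc" "\<And>z. z \<in> unit_disc \<Longrightarrow> \<theta> (\<phi> z) = z"
    using holomorphic_has_inverse[OF hol open_ball inj] unfolding img by metis
  have \<theta>_img: "\<theta> z \<in> unit_disc" if "z \<in> unit_disc" for z
    using that img \<theta>(2) by (metis imageE)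
  have b: "cmod \<beta> < 1" "cmod (- \<beta>) < 1" using \<beta>(1) by auto
  define M N where "M = Moebius_function 0 \<beta>" and "N = Moebius_function 0 (- \<beta>)"
  have MN: "M (N z) = z" "N (M z) = z" if "cmod z < 1" for z
    using Moebius_function_compose[of "\<beta>" "- \<beta>" z] Moebius_function_compose[of "- \<beta>" \<beta> z] b that
    by (auto simp: M_def N_def)
  have M: "M holomorphic_on unit_disc" "M \<beta> = 0" "\<And>z. cmod z < 1 \<Longrightarrow> cmod (M z) < 1"
    using Moebius_function_holomorphic[OF b(1)] Moebius_function_norm_lt_1[OF b(1)]
    by (auto simp: M_def Moebius_function_eq_zero)
  have N: "N holomorphic_on unit_disc" "N 0 = \<beta>" "\<And>z. cmod z < 1 \<Longrightarrow> cmod (N z) < 1"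
    using Moebius_function_holomorphic[OF b(2)] Moebius_function_norm_lt_1[OF b(2)]
    by (auto simp: N_def Moebius_function_of_zero)
  define \<xi> where "\<xi> = (\<lambda>z. \<phi> (N z))"
  define \<kappa> where "\<kappa> = (\<lambda>z. M (\<theta> z))"
  have \<xi>: "\<xi> holomorphic_on unit_disc" "\<xi> 0 = 0" "\<And>z. cmod z < 1 \<Longrightarrow> cmod (\<xi> z) < 1"
    using holomorphic_on_compose_gen[OF N(1) hol] N img \<beta> by (auto simp: \<xi>_def o_def image_subset_iff)
  have \<theta>0: "\<theta> 0 = \<beta>" using \<theta>(2)[OF \<beta>(1)] \<beta>(2) by simp
  have \<kappa>: "\<kappa> holomorphic_on unit_disc" "\<kappa> 0 = 0" "\<And>z. cmod z < 1 \<Longrightarrow> cmod (\<kappa> z) < 1"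
    using holomorphic_on_compose_gen[OF \<theta>(1) M(1)] M \<theta>_img \<theta>0 by (auto simp: \<kappa>_def o_def image_subset_iff)
  have \<kappa>\<xi>: "\<kappa> (\<xi> z) = z" if "cmod z < 1" for z
    using that MN \<theta>(2) N(3) by (simp add: \<kappa>_def \<xi>_def)
  \<comment> \<open>Any nonzero point of the disc would do: the equality case of the Schwarz lemma
    asks for a single one.\<close>
  define h where "h = (1 / 2 :: complex)"
  have h: "cmod h < 1" "h \<noteq> 0" by (auto simp: h_def)
  have "cmod (\<xi> h) = cmod h"
    using Schwarz_Lemma(1)[OF \<xi> h(1)] Schwarz_Lemma(1)[OF \<kappa> \<xi>(3)[OF h(1)]] \<kappa>\<xi>[OF h(1)] by simp
  then obtain \<mu> where \<mu>: "\<forall>z. cmod z < 1 \<longrightarrow> \<xi> z = \<mu> * z" "cmod \<mu> = 1"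
    using Schwarz_Lemma(3)[OF \<xi> h(1)] h by blast
  show thesis
  proof (rule that[OF \<mu>(2)])
    fix z assume "z \<in> unit_disc"
    then show "\<phi> z = \<mu> * ((z - \<beta>) / (1 - cnj \<beta> * z))"
      using \<mu>(1)[rule_format, of "M z"] MN(2)[of z] M(3)[of z]
      by (simp add: \<xi>_def) (simp add: M_def Moebius_function_simple)
  qed
qed

section \<open>The kernel identity of a unitary operator and the bijectivity of
  \<open>\<phi>\<close>\<close>

lemma hardy_inner_cnj:
  assumes "f \<in> hardy2" "g \<in> hardy2"
  shows "cnj (hardy_inner f g) = hardy_inner g f"
  using sums_cnj[THEN iffD2, OF summable_sums[OF hardy2_inner_summable[OF assms]]]
  by (simp add: hardy_inner_def sums_iff mult.commute)

text \<open>
  \<open>S K\<^sub>z = cnj (\<psi> z) K\<^bsub>\<phi> z\<^esub>\<close> for the adjoint \<open>S\<close>; applying \<open>T\<close> and evaluating at \<open>w\<close> gives the identity.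
\<close>

lemma unitary_kernel_identity:
  assumes img: "\<phi> ` unit_disc \<subseteq> unit_disc"
    and U: "hardy_unitary (weighted_comp \<psi> \<phi>)"
    and z: "z \<in> unit_disc" and w: "w \<in> unit_disc"
  shows "\<psi> w * cnj (\<psi> z) * (1 - cnj z * w) = 1 - cnj (\<phi> z) * \<phi> w"
proof -
  define T where "T = weighted_comp \<psi> \<phi>"
  obtain S where S: "\<And>g. g \<in> hardy2 \<Longrightarrow> S g \<in> hardy2"
    "\<And>f g. f \<in> hardy2 \<Longrightarrow> g \<in> hardy2 \<Longrightarrow> hardy_inner (T f) g = hardy_inner f (S g)"
    "\<And>f. f \<in> hardy2 \<Longrightarrow> T (S f) = f"
    using U unfolding T_def hardy_unitary_def hardy_adjoint_def by blast
  have T: "T f \<in> hardy2" if "f \<in> hardy2" for f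
    using U that by (simp add: T_def hardy_unitary_def hardy_bounded_operator_def)
  have K: "hardy_kernel u \<in> hardy2" if "u \<in> unit_disc" for u
    using that by (simp add: hardy_kernel_in_hardy2)
  have \<phi>: "\<phi> u \<in> unit_disc" if "u \<in> unit_disc" for u
    using img that by blast
  \<comment> \<open>The kernel is Hermitian: \<open>cnj (hardy_kernel u (\<phi> z))\<close> is the
    kernel at \<open>\<phi> z\<close> evaluated at \<open>u\<close>.\<close>
  have SK: "S (hardy_kernel z) u = cnj (\<psi> z * hardy_kernel u (\<phi> z))" if u: "u \<in> unit_disc" for u
  proof -
    have "S (hardy_kernel z) u = hardy_inner (S (hardy_kernel z)) (hardy_kernel u)"
      using hardy_inner_kernel[OF hardy2_holomorphic[OF S(1)[OF K[OF z]]] u] by simp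
    also have "\<dots> = cnj (hardy_inner (T (hardy_kernel u)) (hardy_kernel z))"
      using hardy_inner_cnj[OF K[OF u] S(1)[OF K[OF z]]] S(2)[OF K[OF u] K[OF z]] by simp
    also have "\<dots> = cnj (T (hardy_kernel u) z)"
      using hardy_inner_kernel[OF hardy2_holomorphic[OF T[OF K[OF u]]] z] by simp
    finally show ?thesis
      using z by (simp add: T_def weighted_comp_def)
  qed
  have nz: "1 - cnj z * w \<noteq> 0" "1 - \<phi> w * cnj (\<phi> z) \<noteq> 0"
    using hardy_kernel_denom_nonzero[of z w] hardy_kernel_denom_nonzero[of "\<phi> z" "\<phi> w"] z w \<phi>[OF z] \<phi>[OF w]
    by (auto simp: mult.commute)
  have "hardy_kernel z w = T (S (hardy_kernel z)) w"
    by (simp only: S(3)[OF K[OF z]])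
  also have "\<dots> = \<psi> w * cnj (\<psi> z * hardy_kernel (\<phi> w) (\<phi> z))"
    using w SK[OF \<phi>[OF w]] by (simp add: T_def weighted_comp_def)
  finally have "1 / (1 - cnj z * w) = \<psi> w * cnj (\<psi> z) * (1 / (1 - \<phi> w * cnj (\<phi> z)))"
    using w \<phi>[OF z] by (simp add: hardy_kernel_def)
  with nz show ?thesis
    by (simp add: field_simps)
qed

text \<open>Bijectivity is the point. Eliminating \<open>\<psi>\<close> from the kernel identity
  shows that a Moebius map after \<open>\<phi>\<close> is a rotation, which yields an explicit
  two-sided inverse.\<close>

lemma unitary_weighted_comp_automorphism:
  assumes hol: "\<phi> holomorphic_on unit_disc" and img: "\<phi> ` unit_disc \<subseteq> unit_disc"
    and U: "hardy_unitary (weighted_comp \<psi> \<phi>)"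
  shows "disc_automorphism \<phi>"
proof -
  note id = unitary_kernel_identity[OF img U]
  define a where "a = \<phi> 0"
  have a: "cmod a < 1" "cmod (- a) < 1" using img by (force simp: a_def)+
  define M N where "M = Moebius_function 0 a" and "N = Moebius_function 0 (- a)"
  have MN: "M (N z) = z" "N (M z) = z" if "cmod z < 1" for z
    using Moebius_function_compose[of a "- a" z] Moebius_function_compose[of "- a" a z] a that
    by (auto simp: M_def N_def)
  have M_norm: "cmod (M z) < 1" if "cmod z < 1" for z
    using Moebius_function_norm_lt_1[OF a(1) that] by (simp add: M_def)
  have \<phi>: "cmod (\<phi> z) < 1" if "cmod z < 1" for z
    using img that by force
  define \<xi> where "\<xi> = (\<lambda>z. M (\<phi> z))"
  have \<xi>: "cnj (\<xi> z) * \<xi> w = cnj z * w" if z: "cmod z < 1" and w: "cmod w < 1" for z w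
  proof -
    define P Q where "P = \<phi> w" and "Q = cnj (\<phi> z)"
    have "\<psi> w * cnj (\<psi> z) * (1 - cnj z * w) = 1 - Q * P"
      "\<psi> w * cnj (\<psi> 0) = 1 - cnj a * P"
      "\<psi> 0 * cnj (\<psi> z) = 1 - Q * a"
      "\<psi> 0 * cnj (\<psi> 0) = 1 - cnj a * a"
      using id[of z w] id[of 0 w] id[of z 0] id[of 0 0] z w by (auto simp: a_def P_def Q_def)
    \<comment> \<open>The product of the identities at \<open>(0, w)\<close> and
      \<open>(z, 0)\<close> contains the same values of \<open>\<psi>\<close> as the product of
      those at \<open>(z, w)\<close> and \<open>(0, 0)\<close>.\<close>
    then have "(1 - cnj a * P) * (1 - Q * a) * (1 - cnj z * w) = (1 - cnj a * a) * (1 - Q * P)"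
      by (metis (no_types, lifting) mult.assoc mult.commute)
    \<comment> \<open>Uses \<open>(1 - cnj a * a) * (1 - Q * P) = (1 - cnj a * P) * (1 - Q * a) - (P
      - a) * (Q - cnj a)\<close>.\<close>
    then have eq: "(P - a) * (Q - cnj a) = (1 - cnj a * P) * (1 - Q * a) * (cnj z * w)"
      by (simp add: algebra_simps)
    have nz: "1 - cnj a * P \<noteq> 0" "1 - Q * a \<noteq> 0"
      using hardy_kernel_denom_nonzero[OF a(1) \<phi>[OF w]] hardy_kernel_denom_nonzero[OF \<phi>[OF z] a(1)]
      by (auto simp: P_def Q_def)
    have "cnj (\<xi> z) * \<xi> w = ((P - a) * (Q - cnj a)) / ((1 - cnj a * P) * (1 - Q * a))"
      by (simp add: \<xi>_def M_def Moebius_function_simple P_def Q_def mult.commute)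
    then show ?thesis
      unfolding eq using nz by simp
  qed
  \<comment> \<open>Obtained by solving the relation for \<open>\<xi> w\<close> at
    \<open>z = 1 / 2\<close>.\<close>
  define \<mu> where "\<mu> = 1 / (2 * cnj (\<xi> (1 / 2)))"
  have half: "cmod (\<xi> (1 / 2)) = 1 / 2"
  proof -
    have "(cmod (\<xi> (1 / 2)))\<^sup>2 = (1 / 2)\<^sup>2"
      using arg_cong[OF \<xi>[of "1 / 2" "1 / 2"], of cmod] by (simp add: norm_mult power2_eq_square)
    then show ?thesis by (simp add: power2_eq_iff_nonneg)
  qed
  then have nz: "\<xi> (1 / 2) \<noteq> 0" by auto
  have \<mu>1: "cmod \<mu> = 1"
    by (simp add: \<mu>_def norm_divide norm_mult half)
  then have \<mu>2: "\<mu> * cnj \<mu> = 1"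
    using complex_norm_square[of \<mu>] by simp
  have rot: "\<xi> w = \<mu> * w" if "cmod w < 1" for w
    using \<xi>[of "1 / 2" w] that nz by (simp add: \<mu>_def field_simps)
  \<comment> \<open>The candidate inverse of \<open>\<phi>\<close>, read off from
    \<open>M (\<phi> z) = \<mu> * z\<close>.\<close>
  define \<theta> where "\<theta> = (\<lambda>u. cnj \<mu> * M u)"
  have \<theta>: "cmod (\<theta> u) < 1" if "cmod u < 1" for u
    using M_norm[OF that] by (simp add: \<theta>_def norm_mult \<mu>1)
  have \<mu>3: "cnj \<mu> * (\<mu> * z) = z" for z
    using \<mu>2 by (metis mult.assoc mult.commute mult_1)
  have "\<theta> (\<phi> z) = z" if "cmod z < 1" for z
    using rot[OF that] \<mu>3 by (simp add: \<theta>_def \<xi>_def)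
  moreover have "\<phi> (\<theta> u) = u" if u: "cmod u < 1" for u
  proof -
    have "M (\<phi> (\<theta> u)) = M u"
      using rot[OF \<theta>[OF u]] \<mu>2 by (simp add: \<xi>_def) (simp add: \<theta>_def flip: mult.assoc)
    then show ?thesis
      using MN(2)[OF \<phi>[OF \<theta>[OF u]]] MN(2)[OF u] by simp
  qed
  ultimately have "bij_betw \<phi> unit_disc unit_disc"
    using \<theta> \<phi> by (intro bij_betw_byWitness[where f' = \<theta>]) auto
  with hol show ?thesis
    by (simp add: disc_automorphism_def)
qed

theorem theorem6:
  fixes \<phi> \<psi> :: "complex \<Rightarrow> complex"
  assumes "\<phi> holomorphic_on unit_disc"
    and "\<phi> ` unit_disc \<subseteq> unit_disc"
    and "\<psi> holomorphic_on unit_disc"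
    and "hardy_bounded_operator (weighted_comp \<psi> \<phi>)"
  shows "hardy_unitary (weighted_comp \<psi> \<phi>) \<longleftrightarrow>
           disc_automorphism \<phi> \<and>
           (\<exists>\<beta>\<in>unit_disc. \<phi> \<beta> = 0 \<and>
              (\<exists>c. cmod c = 1 \<and>
                 (\<forall>z\<in>unit_disc.
                    \<psi> z = c * hardy_kernel \<beta> z / complex_of_real (hardy_norm (hardy_kernel \<beta>)))))"
    (is "?U \<longleftrightarrow> ?R")
proof
  assume U: ?U
  have aut: "disc_automorphism \<phi>"
    by (rule unitary_weighted_comp_automorphism[OF assms(1,2) U])
  then have "0 \<in> \<phi> ` unit_disc"
    by (simp add: disc_automorphism_def bij_betw_def)
  then obtain \<beta> where \<beta>: "\<beta> \<in> unit_disc" "\<phi> \<beta> = 0"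
    by auto
  define k where "k = hardy_norm (hardy_kernel \<beta>)"
  have pos: "1 - (cmod \<beta>)\<^sup>2 > 0"
    using \<beta>(1) power_strict_mono[of "cmod \<beta>" 1 2] by simp
  have k: "k > 0" "k\<^sup>2 = 1 / (1 - (cmod \<beta>)\<^sup>2)"
    using hardy_norm_kernel[of \<beta>] \<beta>(1) pos by (auto simp: k_def power_divide)
  note id = unitary_kernel_identity[OF assms(2) U \<beta>(1)]
  \<comment> \<open>On the diagonal at \<open>\<beta>\<close> the identity fixes the modulus of
    \<open>\<psi> \<beta>\<close>: it is the norm of the kernel at \<open>\<beta>\<close>.\<close>
  have "\<psi> \<beta> * cnj (\<psi> \<beta>) * (1 - \<beta> * cnj \<beta>) = 1"
    using id[OF \<beta>(1)] \<beta>(2) by (simp add: mult.commute)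
  then have "complex_of_real ((cmod (\<psi> \<beta>))\<^sup>2 * (1 - (cmod \<beta>)\<^sup>2)) = 1"
    by (simp add: complex_norm_square[symmetric] del: of_real_power)
  then have "(cmod (\<psi> \<beta>))\<^sup>2 * (1 - (cmod \<beta>)\<^sup>2) = 1"
    by (simp only: of_real_eq_1_iff)
  then have "(cmod (\<psi> \<beta>))\<^sup>2 = k\<^sup>2"
    using pos by (simp add: k(2) field_simps)
  then have \<psi>\<beta>: "cmod (\<psi> \<beta>) = k"
    using k(1) by (simp add: power2_eq_iff_nonneg)
  then have nz: "\<psi> \<beta> \<noteq> 0" using k(1) by auto
  \<comment> \<open>The identity at \<open>\<beta>\<close> makes \<open>\<psi>\<close> the kernel
    divided by \<open>cnj (\<psi> \<beta>)\<close>; the factor \<open>k\<close> offsets the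
    normalization.\<close>
  define c where "c = complex_of_real k / cnj (\<psi> \<beta>)"
  have "cmod c = 1"
    using k(1) by (simp add: c_def norm_divide \<psi>\<beta>)
  moreover have "\<psi> z = c * hardy_kernel \<beta> z / complex_of_real k" if z: "z \<in> unit_disc" for z
  proof -
    have "\<psi> z * cnj (\<psi> \<beta>) * (1 - cnj \<beta> * z) = 1"
      using id[OF z] \<beta>(2) by simp
    then have "\<psi> z * (cnj (\<psi> \<beta>) * (1 - cnj \<beta> * z)) = 1"
      by (simp only: mult.assoc)
    then have "\<psi> z = 1 / (cnj (\<psi> \<beta>) * (1 - cnj \<beta> * z))"
      by (metis eq_divide_imp mult_zero_right zero_neq_one)
    then show ?thesis
      using k(1) z by (simp add: c_def hardy_kernel_def)
  qed
  ultimately show ?R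
    using aut \<beta> unfolding k_def by blast
next
  assume ?R
  then obtain \<beta> c where aut: "disc_automorphism \<phi>" and \<beta>: "\<beta> \<in> unit_disc" "\<phi> \<beta> = 0"
    and c: "cmod c = 1"
    and \<psi>: "\<And>z. z \<in> unit_disc \<Longrightarrow> \<psi> z = c * hardy_kernel \<beta> z / complex_of_real (hardy_norm (hardy_kernel \<beta>))"
    by blast
  obtain \<mu> where \<mu>: "cmod \<mu> = 1"
    and \<phi>: "\<And>z. z \<in> unit_disc \<Longrightarrow> \<phi> z = \<mu> * ((z - \<beta>) / (1 - cnj \<beta> * z))"
    using disc_automorphism_moebius[OF aut \<beta>] by blast
  have \<beta>1: "cmod \<beta> < 1" using \<beta>(1) by simp
  have pos: "1 - (cmod \<beta>)\<^sup>2 > 0"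
    using \<beta>1 power_strict_mono[of "cmod \<beta>" 1 2] by simp
  show ?U
  proof (rule weighted_moebius_unitary[OF \<beta>1 \<mu> _ \<phi> _ assms(4)])
    \<comment> \<open>Here \<open>d\<close> is \<open>c\<close> divided by the norm of the kernel,
      which is \<open>1 / sqrt (1 - (cmod \<beta>)^2)\<close>.\<close>
    show "(cmod (c * complex_of_real (sqrt (1 - (cmod \<beta>)\<^sup>2))))\<^sup>2 = 1 - (cmod \<beta>)\<^sup>2"
      using pos by (simp add: norm_mult c)
    show "\<psi> z = c * complex_of_real (sqrt (1 - (cmod \<beta>)\<^sup>2)) * (1 / (1 - cnj \<beta> * z))" if "z \<in> unit_disc" for z
      using that by (simp add: \<psi>[OF that] hardy_norm_kernel[OF \<beta>1] hardy_kernel_def)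
  qed
qed

end
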